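(* The set $$Z=\{z\in\mathbb{C}^4 : \exists\, v\in\mathbb{S}\ \text{such that}\ \Pi(z,v)=0\}$$ is a complex hypersurface in $\mathbb{C}^4$, described by the equation $$z_0^2+z_1^2+z_2^2+z_3^2=0.$$ In particular, $Z$ is the only critical level of the function $\Phi:\mathbb{C}^4\to\mathbb{C}$, $\Phi(z)=z_0^2+z_1^2+z_2^2+z_3^2$, and the only critical point of $\Phi$ is the origin.
   Context: $\mathbb{H}$ is the algebra of quaternions with standard real basis $1,i,j,k$, and $\mathbb{S}=\{q\in\mathbb{H}: q^2=-1\}$ is the sphere of imaginary units. The imaginary unit of $\mathbb{C}$ is denoted $\iota$. For $v\in\mathbb{S}$, $\rho_v:\mathbb{C}\to\mathbb{H}$ is $\rho_v(x+\iota y)=x+vy$ ($x,y\in\mathbb{R}$). It is extended to $\mathbb{C}^4\cong\mathbb{H}\otimes_{\mathbb{R}}\mathbb{C}$ by $\rho_v(z_0,z_1,z_2,z_3)=\rho_v(z_0)+\rho_v(z_1)i+\rho_v(z_2)j+\rho_v(z_3)k$. The map $\Pi:\mathbb{C}^4\times\mathbb{S}\to\mathbb{H}$ is $\Pi(z,v)=\rho_v(z)$. *)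

theory Defs
  imports "HOL-Analysis.Analysis"
begin

section \<open>The algebra of quaternions\<close>

datatype quat = Quat (quat_re: real) (quat_im1: real) (quat_im2: real) (quat_im3: real)

lemma quat_eq_iff:
  "p = q \<longleftrightarrow> quat_re p = quat_re q \<and> quat_im1 p = quat_im1 q \<and>
     quat_im2 p = quat_im2 q \<and> quat_im3 p = quat_im3 q"
  by (cases p; cases q) simp

instantiation quat :: real_algebra_1
begin

definition zero_quat :: quat where "0 = Quat 0 0 0 0"

definition one_quat :: quat where "1 = Quat 1 0 0 0"

definition plus_quat :: "quat \<Rightarrow> quat \<Rightarrow> quat" where
  "p + q = Quat (quat_re p + quat_re q) (quat_im1 p + quat_im1 q)
                (quat_im2 p + quat_im2 q) (quat_im3 p + quat_im3 q)"

definition uminus_quat :: "quat \<Rightarrow> quat" where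
  "- q = Quat (- quat_re q) (- quat_im1 q) (- quat_im2 q) (- quat_im3 q)"

definition minus_quat :: "quat \<Rightarrow> quat \<Rightarrow> quat" where
  "p - q = Quat (quat_re p - quat_re q) (quat_im1 p - quat_im1 q)
                (quat_im2 p - quat_im2 q) (quat_im3 p - quat_im3 q)"

definition scaleR_quat :: "real \<Rightarrow> quat \<Rightarrow> quat" where
  "r *\<^sub>R q = Quat (r * quat_re q) (r * quat_im1 q) (r * quat_im2 q) (r * quat_im3 q)"

definition times_quat :: "quat \<Rightarrow> quat \<Rightarrow> quat" where
  "p * q = Quat
     (quat_re p * quat_re q - quat_im1 p * quat_im1 q - quat_im2 p * quat_im2 q - quat_im3 p * quat_im3 q)
     (quat_re p * quat_im1 q + quat_im1 p * quat_re q + quat_im2 p * quat_im3 q - quat_im3 p * quat_im2 q)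
     (quat_re p * quat_im2 q - quat_im1 p * quat_im3 q + quat_im2 p * quat_re q + quat_im3 p * quat_im1 q)
     (quat_re p * quat_im3 q + quat_im1 p * quat_im2 q - quat_im2 p * quat_im1 q + quat_im3 p * quat_re q)"

instance
  by standard
    (simp_all add: quat_eq_iff zero_quat_def one_quat_def plus_quat_def uminus_quat_def
      minus_quat_def scaleR_quat_def times_quat_def algebra_simps)

end

definition quat_i :: quat where "quat_i = Quat 0 1 0 0"
definition quat_j :: quat where "quat_j = Quat 0 0 1 0"
definition quat_k :: quat where "quat_k = Quat 0 0 0 1"

lemma quat_basis_relations:
  "quat_i * quat_i = - 1" "quat_j * quat_j = - 1" "quat_k * quat_k = - 1"
  "quat_i * quat_j = quat_k" "quat_j * quat_k = quat_i" "quat_k * quat_i = quat_j"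
  by (simp_all add: quat_i_def quat_j_def quat_k_def times_quat_def uminus_quat_def one_quat_def)

definition imag_units :: "quat set" where
  "imag_units = {q. q\<^sup>2 = - 1}"


section \<open>The maps \<open>\<rho>\<^sub>v\<close> and \<open>\<Pi>\<close>, the set \<open>Z\<close> and the function \<open>\<Phi>\<close>\<close>

text \<open>
  Only the values for \<open>v \<in> imag_units\<close> are meaningful.
\<close>

definition rho :: "quat \<Rightarrow> complex \<Rightarrow> quat" where
  "rho v w = of_real (Re w) + v * of_real (Im w)"

text \<open>
  The index type \<open>4\<close> is the ring of integers modulo 4, whose elements are \<open>0, 1, 2, 3\<close>; hence
  \<open>z $ 0, \<dots>, z $ 3\<close> are the four distinct coordinates of \<open>z\<close>.
\<close>

definition rho4 :: "quat \<Rightarrow> complex^4 \<Rightarrow> quat" where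
  "rho4 v z = rho v (z $ 0) + rho v (z $ 1) * quat_i + rho v (z $ 2) * quat_j + rho v (z $ 3) * quat_k"

definition Pi_map :: "complex^4 \<Rightarrow> quat \<Rightarrow> quat" where
  "Pi_map z v = rho4 v z"

definition Z_set :: "(complex^4) set" where
  "Z_set = {z. \<exists>v\<in>imag_units. Pi_map z v = 0}"

definition Phi :: "complex^4 \<Rightarrow> complex" where
  "Phi z = (z $ 0)\<^sup>2 + (z $ 1)\<^sup>2 + (z $ 2)\<^sup>2 + (z $ 3)\<^sup>2"


section \<open>Holomorphic functions of several variables, hypersurfaces, critical points\<close>

definition holomorphic_vec_on :: "(complex^'n \<Rightarrow> complex) \<Rightarrow> (complex^'n) set \<Rightarrow> bool" where
  "holomorphic_vec_on f U \<longleftrightarrow> open U \<and>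
     (\<forall>z\<in>U. \<exists>D. Vector_Spaces.linear (*s) (*) D \<and> (f has_derivative D) (at z))"

text \<open>
  A (possibly singular) complex hypersurface: a nonempty set that, near every point of the ambient
  space, is the zero set of a holomorphic function which is not identically zero. Letting \<open>p\<close> range
  over the whole ambient space makes such a set closed. As \<open>U\<close> is connected, a function that
  is not identically zero on \<open>U\<close> does not vanish identically near any point of \<open>U\<close>.
\<close>

definition complex_hypersurface :: "(complex^'n) set \<Rightarrow> bool" where
  "complex_hypersurface M \<longleftrightarrow> M \<noteq> {} \<and>
     (\<forall>p. \<exists>U f. open U \<and> connected U \<and> p \<in> U \<and> holomorphic_vec_on f U \<and>
        (\<exists>z\<in>U. f z \<noteq> 0) \<and> M \<inter> U = {z\<in>U. f z = 0})"

definition critical_point :: "(complex^'n \<Rightarrow> complex) \<Rightarrow> complex^'n \<Rightarrow> bool" where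
  "critical_point f z \<longleftrightarrow> (f has_derivative (\<lambda>_. 0)) (at z)"

definition critical_level :: "(complex^'n \<Rightarrow> complex) \<Rightarrow> (complex^'n) set \<Rightarrow> bool" where
  "critical_level f L \<longleftrightarrow> (\<exists>c. L = f -` {c}) \<and> (\<exists>z\<in>L. critical_point f z)"

end

theory Submission imports Defs begin

text \<open>
  Write \<open>z = a + \<iota> b\<close> with \<open>a, b\<close> quaternions, the coordinatewise real and imaginary parts of \<open>z\<close>.
  Since \<open>v\<close> multiplies from the left, \<open>\<Pi>(z, v) = a + v b\<close>, while
  \<open>\<Phi>(z) = (|a|\<^sup>2 - |b|\<^sup>2) + 2 \<iota> \<langle>a, b\<rangle>\<close> for the Euclidean inner product. So \<open>\<Phi>(z) = 0\<close> says
  that \<open>a\<close> and \<open>b\<close> are orthogonal vectors of equal length, and \<open>z \<in> Z\<close> says that \<open>a = - v b\<close> for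
  some imaginary unit \<open>v\<close>. These agree, because imaginary units are exactly the quaternions with
  zero real part and length one (\<open>imag_units_iff\<close>): left multiplication by such a \<open>v\<close> preserves
  lengths and sends \<open>b\<close> to a vector orthogonal to \<open>b\<close>; conversely, if \<open>b \<noteq> 0\<close>, the quotient
  \<open>- a b\<^sup>-\<^sup>1\<close> has length \<open>|a| / |b| = 1\<close> and its real part is \<open>- \<langle>a, b\<rangle> / |b|\<^sup>2 = 0\<close>
  (\<open>ex_imag_unit_iff\<close>).

  Thus \<open>Z\<close> is the zero set of a single nonzero polynomial, which serves as a local equation at
  every point. The differential \<open>2 \<Sum> z\<^sub>k dz\<^sub>k\<close> of \<open>\<Phi>\<close> vanishes only at the origin, where
  \<open>\<Phi> = 0\<close>, so the zero level is the only critical one.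
\<close>

section \<open>Imaginary units and the Euclidean inner product of quaternions\<close>

definition quat_inner :: "quat \<Rightarrow> quat \<Rightarrow> real" where
  "quat_inner p q = quat_re p * quat_re q + quat_im1 p * quat_im1 q
     + quat_im2 p * quat_im2 q + quat_im3 p * quat_im3 q"

definition quat_conj :: "quat \<Rightarrow> quat" where
  "quat_conj q = Quat (quat_re q) (- quat_im1 q) (- quat_im2 q) (- quat_im3 q)"

lemmas quat_arith_defs = zero_quat_def one_quat_def plus_quat_def uminus_quat_def
  minus_quat_def scaleR_quat_def times_quat_def quat_conj_def quat_inner_def

lemma quat_inner_mult: "quat_inner (p * q) (p * q) = quat_inner p p * quat_inner q q"
  by (simp add: quat_arith_defs algebra_simps)

lemma quat_inner_mult_right: "quat_inner (p * q) q = quat_re p * quat_inner q q"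
  by (simp add: quat_arith_defs algebra_simps)

lemma quat_re_mult_conj: "quat_re (p * quat_conj q) = quat_inner p q"
  by (simp add: quat_arith_defs)

lemma quat_conj_mult_self: "quat_conj q * q = quat_inner q q *\<^sub>R 1"
  by (simp add: quat_arith_defs algebra_simps)

lemma quat_inner_conj: "quat_inner (quat_conj q) (quat_conj q) = quat_inner q q"
  by (simp add: quat_arith_defs)

lemma quat_inner_scaleR: "quat_inner (r *\<^sub>R p) (s *\<^sub>R q) = r * s * quat_inner p q"
  by (simp add: quat_arith_defs algebra_simps)

lemma quat_inner_minus:
  "quat_inner (- p) q = - quat_inner p q" "quat_inner p (- q) = - quat_inner p q"
  by (simp_all add: quat_arith_defs)

lemma quat_inner_self_eq_0_iff: "quat_inner q q = 0 \<longleftrightarrow> q = 0"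
proof -
  have sum_zero: "a * a + b * b + c * c + d * d = 0 \<longleftrightarrow> a = 0 \<and> b = 0 \<and> c = 0 \<and> d = 0"
    for a b c d :: real
    by (simp add: add_nonneg_eq_0_iff)
  show ?thesis
    by (simp add: quat_eq_iff quat_inner_def zero_quat_def sum_zero)
qed

text \<open>
  The imaginary components of \<open>v\<^sup>2\<close> are \<open>2 (Re v)\<close> times those of \<open>v\<close>. Hence \<open>v\<^sup>2 = -1\<close> with
  \<open>Re v \<noteq> 0\<close> would make \<open>v\<close> real, and no real number squares to \<open>-1\<close>.
\<close>

lemma imag_units_iff: "v \<in> imag_units \<longleftrightarrow> quat_re v = 0 \<and> quat_inner v v = 1"
proof (cases v)
  case (Quat a b c d)
  have square: "v\<^sup>2 = - 1 \<longleftrightarrow>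
      a * a - b * b - c * c - d * d = - 1 \<and> a * b = 0 \<and> a * c = 0 \<and> a * d = 0"
    unfolding Quat by (auto simp: power2_eq_square quat_eq_iff quat_arith_defs algebra_simps)
  show ?thesis
  proof (cases "a = 0")
    case True
    then show ?thesis
      unfolding imag_units_def mem_Collect_eq square
      by (auto simp: Quat quat_inner_def)
  next
    case False
    have "a * a \<noteq> - 1"
      using zero_le_square[of a] by linarith
    with False show ?thesis
      unfolding imag_units_def mem_Collect_eq square by (auto simp: Quat)
  qed
qed

lemma ex_imag_unit_iff:
  "(\<exists>v\<in>imag_units. a + v * b = 0) \<longleftrightarrow>
     quat_inner a a = quat_inner b b \<and> quat_inner a b = 0"
proof
  assume "\<exists>v\<in>imag_units. a + v * b = 0"
  then obtain v where v: "v \<in> imag_units" and "a + v * b = 0" by blast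
  then have a: "a = - (v * b)"
    by (simp add: eq_neg_iff_add_eq_0)
  show "quat_inner a a = quat_inner b b \<and> quat_inner a b = 0"
    using v unfolding a imag_units_iff
    by (simp add: quat_inner_minus quat_inner_mult quat_inner_mult_right)
next
  assume ab: "quat_inner a a = quat_inner b b \<and> quat_inner a b = 0"
  show "\<exists>v\<in>imag_units. a + v * b = 0"
  proof (cases "b = 0")
    case True
    have "quat_i \<in> imag_units"
      by (simp add: imag_units_iff quat_i_def quat_inner_def)
    moreover have "a = 0"
      using ab True quat_inner_self_eq_0_iff by metis
    ultimately show ?thesis
      using True by auto
  next
    case False
    define n where "n = quat_inner b b"
    have n: "n \<noteq> 0"
      using False by (simp add: n_def quat_inner_self_eq_0_iff)
    \<comment> \<open>The inverse of \<open>b\<close> is \<open>quat_conj b\<close> divided by \<open>n\<close>, so this is \<open>- a b\<^sup>-\<^sup>1\<close>.\<close>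
    define v where "v = (- 1 / n) *\<^sub>R (a * quat_conj b)"
    have "quat_re v = (- 1 / n) * quat_re (a * quat_conj b)"
      by (simp only: v_def scaleR_quat_def quat.sel)
    then have "quat_re v = 0"
      using ab by (simp add: quat_re_mult_conj)
    moreover have "quat_inner v v = 1"
      using ab n
      by (simp add: v_def quat_inner_scaleR quat_inner_mult quat_inner_conj quat_inner_minus flip: n_def)
    moreover have "v * b = - a"
      using n by (simp add: v_def mult.assoc quat_conj_mult_self flip: n_def)
    ultimately show ?thesis
      by (intro bexI[of _ v]) (simp_all add: imag_units_iff)
  qed
qed


section \<open>The equation of \<open>Z\<close>\<close>

definition Re_quat :: "complex^4 \<Rightarrow> quat" where
  "Re_quat z = Quat (Re (z $ 0)) (Re (z $ 1)) (Re (z $ 2)) (Re (z $ 3))"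

definition Im_quat :: "complex^4 \<Rightarrow> quat" where
  "Im_quat z = Quat (Im (z $ 0)) (Im (z $ 1)) (Im (z $ 2)) (Im (z $ 3))"

lemma Pi_map_eq: "Pi_map z v = Re_quat z + v * Im_quat z"
  by (simp add: Pi_map_def rho4_def rho_def of_real_def quat_eq_iff Re_quat_def Im_quat_def
      quat_arith_defs quat_i_def quat_j_def quat_k_def)

lemma Phi_eq_Complex:
  "Phi z = Complex (quat_inner (Re_quat z) (Re_quat z) - quat_inner (Im_quat z) (Im_quat z))
             (2 * quat_inner (Re_quat z) (Im_quat z))"
  by (simp add: complex_eq_iff Phi_def Re_quat_def Im_quat_def quat_inner_def power2_eq_square)

lemma Z_set_eq_Phi_zeros: "Z_set = {z. Phi z = 0}"
  unfolding Z_set_def Pi_map_eq ex_imag_unit_iff Phi_eq_Complex by (simp add: complex_eq_iff)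


section \<open>The differential of \<open>\<Phi>\<close>\<close>

definition Phi_differential :: "complex^4 \<Rightarrow> complex^4 \<Rightarrow> complex" where
  "Phi_differential z h = 2 * (z $ 0 * h $ 0 + z $ 1 * h $ 1 + z $ 2 * h $ 2 + z $ 3 * h $ 3)"

lemma has_derivative_Phi: "(Phi has_derivative Phi_differential z) (at z)"
proof -
  note [derivative_intros] = bounded_linear.has_derivative[OF bounded_linear_vec_nth]
  show ?thesis
    unfolding Phi_def Phi_differential_def
    by (auto intro!: derivative_eq_intros simp: algebra_simps)
qed

lemma linear_Phi_differential: "Vector_Spaces.linear (*s) (*) (Phi_differential z)"
  by unfold_locales (simp_all add: Phi_differential_def algebra_simps)

lemma holomorphic_vec_on_Phi: "open U \<Longrightarrow> holomorphic_vec_on Phi U"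
  unfolding holomorphic_vec_on_def using has_derivative_Phi linear_Phi_differential by blast

lemma vec4_eq_0_iff:
  fixes z :: "complex^4"
  shows "z = 0 \<longleftrightarrow> z $ 0 = 0 \<and> z $ 1 = 0 \<and> z $ 2 = 0 \<and> z $ 3 = 0"
proof -
  have four: "(4 :: 4) = 0" by simp
  show ?thesis
    unfolding vec_eq_iff forall_4 four by auto
qed

text \<open>The \<open>k\<close>-th partial derivative \<open>2 z\<^sub>k\<close> is read off by applying the differential to the \<open>k\<close>-th
  unit vector.\<close>

lemma critical_point_Phi_iff: "critical_point Phi z \<longleftrightarrow> z = 0"
proof
  assume "critical_point Phi z"
  then have zero: "Phi_differential z = (\<lambda>_. 0)"
    unfolding critical_point_def using has_derivative_Phi has_derivative_unique by blast
  have "Phi_differential z (axis k 1) = 2 * z $ k" if "k \<in> {0, 1, 2, 3}" for k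
    using that by (auto simp: Phi_differential_def axis_def)
  then show "z = 0"
    unfolding zero vec4_eq_0_iff by simp
next
  assume "z = 0"
  then have "Phi_differential z = (\<lambda>_. 0)"
    by (simp add: Phi_differential_def fun_eq_iff)
  then show "critical_point Phi z"
    unfolding critical_point_def using has_derivative_Phi by metis
qed

lemma critical_level_Phi_iff: "critical_level Phi L \<longleftrightarrow> L = {z. Phi z = 0}"
proof -
  have "Phi 0 = 0"
    by (simp add: Phi_def)
  then show ?thesis
    unfolding critical_level_def critical_point_Phi_iff by auto
qed

lemma complex_hypersurface_Phi_zeros: "complex_hypersurface {z. Phi z = 0}"
  unfolding complex_hypersurface_def
proof (intro conjI allI)
  have "Phi 0 = 0"
    by (simp add: Phi_def)
  then show "{z. Phi z = 0} \<noteq> {}"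
    by blast
next
  fix p :: "complex^4"
  have "Phi (axis 0 1) = 1"
    by (simp add: Phi_def axis_def)
  then have "\<exists>z\<in>UNIV. Phi z \<noteq> 0"
    by (metis UNIV_I zero_neq_one)
  then show "\<exists>U f. open U \<and> connected U \<and> p \<in> U \<and> holomorphic_vec_on f U \<and>
      (\<exists>z\<in>U. f z \<noteq> 0) \<and> {z. Phi z = 0} \<inter> U = {z\<in>U. f z = 0}"
    by (intro exI[of _ UNIV] exI[of _ Phi]) (simp add: holomorphic_vec_on_Phi connected_UNIV)
qed

theorem theorem3p3:
  "complex_hypersurface Z_set
   \<and> Z_set = {z. (z $ 0)\<^sup>2 + (z $ 1)\<^sup>2 + (z $ 2)\<^sup>2 + (z $ 3)\<^sup>2 = 0}
   \<and> {L. critical_level Phi L} = {Z_set}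
   \<and> {z. critical_point Phi z} = {0}"
  using complex_hypersurface_Phi_zeros
  by (simp add: Z_set_eq_Phi_zeros critical_level_Phi_iff critical_point_Phi_iff)
     (simp add: Phi_def)

end
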